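(* Let $A\in\mathbb R^{n\times n}$ be stable and let $K(A)$ be its Kreiss constant. Then $$K(A)=\max_{\delta\in[-1,1]}\left\|\left(sI-\left(\tfrac{1-\delta}{1+\delta}A-I\right)\right)^{-1}\right\|_\infty=\max_{\delta\in[-1,1]}\ \max_{\omega\in[0,\infty]}\ \overline{\sigma}\left(\left(j\omega I-\left(\tfrac{1-\delta}{1+\delta}A-I\right)\right)^{-1}\right),$$ where for $\delta=-1$ the matrix $\left(sI-\left(\tfrac{1-\delta}{1+\delta}A-I\right)\right)^{-1}$ is understood to be the zero matrix.
   Context: A matrix $A\in\mathbb R^{n\times n}$ is stable if all its eigenvalues have strictly negative real part. $\|\cdot\|$ applied to a matrix is the spectral norm (maximum singular value $\overline\sigma$). The Kreiss constant of a stable matrix $A$ is $$K(A)=\sup_{\mathrm{Re}(s)>0}\mathrm{Re}(s)\,\|(sI-A)^{-1}\|,$$ the supremum being over complex $s$ with positive real part. For a stable transfer function $T(s)$, $\|T\|_\infty=\sup_{\omega\in\mathbb R}\overline\sigma(T(j\omega))$ is the $H_\infty$-norm, where $j$ is the imaginary unit. At $\omega=\infty$ the value of $\overline\sigma\big((j\omega I-M)^{-1}\big)$ is understood as its limit $0$. *)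

theory Defs
  imports "HOL-Analysis.Analysis" "HOL-Library.Extended_Real"
begin

abbreviation complex_matrix :: "real^'n^'m \<Rightarrow> complex^'n^'m" where
  "complex_matrix A \<equiv> map_matrix complex_of_real A"

definition eigenvalue :: "complex^'n^'n \<Rightarrow> complex \<Rightarrow> bool" where
  "eigenvalue M l \<longleftrightarrow> (\<exists>v. v \<noteq> 0 \<and> M *v v = l *s v)"

definition stable :: "real^'n^'n \<Rightarrow> bool" where
  "stable A \<longleftrightarrow> (\<forall>l. eigenvalue (complex_matrix A) l \<longrightarrow> Re l < 0)"

definition hermitian_adjoint :: "complex^'n^'m \<Rightarrow> complex^'m^'n" where
  "hermitian_adjoint M = map_matrix cnj (transpose M)"

definition singular_value :: "complex^'n^'n \<Rightarrow> real \<Rightarrow> bool" where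
  "singular_value M r \<longleftrightarrow>
     0 \<le> r \<and> eigenvalue (hermitian_adjoint M ** M) (complex_of_real (r\<^sup>2))"

text \<open>The spectral norm. The set of singular values is finite and nonempty, so \<open>Max\<close> is
  meaningful here.\<close>

definition sigma_max :: "complex^'n^'n \<Rightarrow> real" where
  "sigma_max M = Max {r. singular_value M r}"

definition resolvent :: "real^'n^'n \<Rightarrow> complex \<Rightarrow> complex^'n^'n" where
  "resolvent A s = matrix_inv (mat s - complex_matrix A)"

text \<open>Suprema are taken in the extended reals, so that they are genuine suprema without
  presupposing boundedness.\<close>

definition kreiss_constant :: "real^'n^'n \<Rightarrow> ereal" where
  "kreiss_constant A = (SUP s\<in>{s. 0 < Re s}. ereal (Re s * sigma_max (resolvent A s)))"

definition Hinf_norm :: "(complex \<Rightarrow> complex^'n^'n) \<Rightarrow> ereal" where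
  "Hinf_norm T = (SUP w::real. ereal (sigma_max (T (\<i> * complex_of_real w))))"

text \<open>The convention at \<open>\<delta> = -1\<close> has to be explicit: \<open>(1 - \<delta>) / (1 + \<delta>)\<close> would be \<open>2 / 0 = 0\<close>.\<close>

definition kreiss_transfer :: "real^'n^'n \<Rightarrow> real \<Rightarrow> complex \<Rightarrow> complex^'n^'n" where
  "kreiss_transfer A \<delta> s =
     (if \<delta> = -1 then 0
      else resolvent (((1 - \<delta>) / (1 + \<delta>)) *\<^sub>R A - mat 1) s)"

text \<open>The gain at frequency \<open>\<infinity>\<close> is the limit \<open>0\<close> of the gain of a resolvent at large
  frequencies.\<close>

definition kreiss_gain :: "real^'n^'n \<Rightarrow> real \<Rightarrow> ereal \<Rightarrow> real" where
  "kreiss_gain A \<delta> w =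
     (if w = \<infinity> then 0
      else sigma_max (kreiss_transfer A \<delta> (\<i> * complex_of_real (real_of_ereal w))))"

definition is_maximum :: "('a \<Rightarrow> 'b::order) \<Rightarrow> 'a set \<Rightarrow> 'b \<Rightarrow> bool" where
  "is_maximum f S m \<longleftrightarrow> (\<exists>x\<in>S. f x = m) \<and> (\<forall>x\<in>S. f x \<le> m)"

end

theory Submission
  imports Defs
begin

text \<open>For \<open>-1 < \<delta> < 1\<close> put \<open>t = (1 - \<delta>) / (1 + \<delta>)\<close> and \<open>s = (1 + \<i> w) / t\<close>. Then
  \<open>\<i> w I - (t A - I) = t (s I - A)\<close> and \<open>Re s = 1 / t\<close>, so the gain at \<open>(\<delta>, w)\<close> is the Kreiss
  quotient at \<open>s\<close>, and all \<open>s\<close> with positive real part arise. At \<open>\<delta> = 1\<close> the maximal gain is \<open>1\<close>,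
  the limit of the Kreiss quotient at real \<open>s \<rightarrow> \<infinity>\<close>; if the supremum exceeds \<open>1\<close>, it is attained
  at some \<open>s\<close> by compactness.

  The norm of an inverse is handled through the least gain of the matrix on unit vectors,
  of which it is the reciprocal: the least gain is Lipschitz in the matrix, so no continuity of
  matrix inversion is needed.\<close>

section \<open>The largest singular value as an operator norm\<close>

text \<open>\<open>inner\<close> on complex vectors is the real part of the Hermitian product, so
  the adjoint relation holds for the real inner product too and real Euclidean tools apply.\<close>

lemma inner_hermitian_adjoint:
  fixes M :: "complex^'n^'m"
  shows "inner (M *v x) y = inner x (hermitian_adjoint M *v y)"
proof -
  have inner: "inner a b = Re (a * cnj b)" for a b :: complex
    by (simp add: inner_complex_def)
  have "inner (M *v x) y = (\<Sum>i\<in>UNIV. \<Sum>j\<in>UNIV. Re (M $ i $ j * x $ j * cnj (y $ i)))"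
    by (simp add: inner_vec_def matrix_vector_mult_def inner sum_distrib_right Re_sum
        del: times_complex.sel)
  also have "\<dots> = (\<Sum>j\<in>UNIV. \<Sum>i\<in>UNIV. Re (M $ i $ j * x $ j * cnj (y $ i)))"
    by (rule sum.swap)
  also have "\<dots> = inner x (hermitian_adjoint M *v y)"
    by (simp add: inner_vec_def matrix_vector_mult_def inner hermitian_adjoint_def
        map_matrix_def transpose_def sum_distrib_left Re_sum mult_ac del: times_complex.sel)
  finally show ?thesis .
qed

lemma of_real_vector_scalar_mult:
  fixes v :: "complex^'n"
  shows "complex_of_real r *s v = r *\<^sub>R v"
  by (simp add: vec_eq_iff scaleR_conv_of_real[where 'a = complex])

lemma norm_vector_scalar_mult:
  fixes v :: "complex^'n"
  shows "norm (c *s v) = cmod c * norm v"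
  by (simp add: norm_vec_def norm_mult L2_set_right_distrib)

lemma mat_mult_vec:
  fixes v :: "complex^'n"
  shows "mat c *v v = c *s v"
  by (simp add: vec_eq_iff matrix_vector_mult_def mat_def if_distrib if_distribR cong: if_cong)

lemma singular_value_iff:
  fixes M :: "complex^'n^'n"
  shows "singular_value M r \<longleftrightarrow>
    0 \<le> r \<and> (\<exists>v. v \<noteq> 0 \<and> hermitian_adjoint M *v (M *v v) = r\<^sup>2 *\<^sub>R v)"
  unfolding singular_value_def eigenvalue_def of_real_vector_scalar_mult
  by (simp add: matrix_vector_mul_assoc)

text \<open>Eigenvectors of the self-adjoint matrix \<open>hermitian_adjoint M ** M\<close> for
  distinct eigenvalues are orthogonal, hence independent over the reals, so only finitely many
  occur. This gives \<open>Max\<close> in \<open>sigma_max\<close> its meaning.\<close>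

lemma finite_singular_values:
  fixes M :: "complex^'n^'n"
  shows "finite {r. singular_value M r}"
proof -
  let ?S = "{r. singular_value M r}"
  have "\<forall>r\<in>?S. \<exists>v. v \<noteq> 0 \<and> hermitian_adjoint M *v (M *v v) = r\<^sup>2 *\<^sub>R v"
    by (auto simp: singular_value_iff)
  then obtain v where v: "\<And>r. r \<in> ?S \<Longrightarrow> v r \<noteq> 0"
    "\<And>r. r \<in> ?S \<Longrightarrow> hermitian_adjoint M *v (M *v v r) = r\<^sup>2 *\<^sub>R v r"
    by metis
  have orth: "inner (v r) (v q) = 0" if "r \<in> ?S" "q \<in> ?S" "r \<noteq> q" for r q
  proof -
    have "r\<^sup>2 * inner (v r) (v q) = inner (M *v v q) (M *v v r)"
      by (simp add: inner_hermitian_adjoint v(2)[OF that(1)] inner_commute)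
    also have "\<dots> = inner (M *v v r) (M *v v q)"
      by (rule inner_commute)
    also have "\<dots> = q\<^sup>2 * inner (v r) (v q)"
      by (simp add: inner_hermitian_adjoint v(2)[OF that(2)])
    finally have "(r\<^sup>2 - q\<^sup>2) * inner (v r) (v q) = 0"
      by (simp add: algebra_simps)
    moreover have "r\<^sup>2 \<noteq> q\<^sup>2"
      using that by (simp add: singular_value_def)
    ultimately show ?thesis
      by simp
  qed
  have "inj_on v ?S"
    using orth v(1) by (metis inj_onI inner_eq_zero_iff)
  moreover have "finite (v ` ?S)"
  proof (rule independent_imp_finite, rule pairwise_orthogonal_independent)
    show "pairwise orthogonal (v ` ?S)"
      using orth by (auto simp: pairwise_def orthogonal_def)
    show "0 \<notin> v ` ?S"
      using v(1) by force
  qed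
  ultimately show ?thesis
    by (rule finite_imageD[rotated])
qed

text \<open>A unit vector at which the gain of \<open>M\<close> is maximal is an eigenvector of \<open>M\<^sup>* M\<close>:
  equality is forced in \<open>\<bar>M\<^sup>* M v\<bar> \<le> L\<^sup>2\<close> and the Cauchy--Schwarz inequality.\<close>

lemma sigma_max_eqI:
  fixes M :: "complex^'n^'n"
  assumes bound: "\<And>x. norm (M *v x) \<le> L * norm x"
    and v: "norm v = 1" "norm (M *v v) = L"
  shows "sigma_max M = L"
  unfolding sigma_max_def
proof (rule Max_eqI)
  show "finite {r. singular_value M r}"
    by (rule finite_singular_values)
next
  fix r assume "r \<in> {r. singular_value M r}"
  then obtain w where w: "0 \<le> r" "w \<noteq> 0" "hermitian_adjoint M *v (M *v w) = r\<^sup>2 *\<^sub>R w"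
    by (auto simp: singular_value_iff)
  have "(norm (M *v w))\<^sup>2 = (r * norm w)\<^sup>2"
    unfolding power2_norm_eq_inner power_mult_distrib
    by (simp add: inner_hermitian_adjoint w)
  then have "r * norm w = norm (M *v w)"
    using w by (simp add: power2_eq_iff_nonneg)
  also have "\<dots> \<le> L * norm w"
    by (rule bound)
  finally show "r \<le> L"
    using w by simp
next
  let ?N = "hermitian_adjoint M"
  have L: "0 \<le> L"
    using v by auto
  \<comment> \<open>The bound for \<open>M\<close> at the vector \<open>?N *v y\<close>, after one
    factor \<open>norm (?N *v y)\<close> is cancelled, carries over to the adjoint.\<close>
  have adj: "norm (?N *v y) \<le> L * norm y" for y
  proof (cases "?N *v y = 0")
    case False
    have "norm (?N *v y) * norm (?N *v y) = inner (?N *v y) (?N *v y)"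
      by (simp add: power2_norm_eq_inner[symmetric] power2_eq_square)
    also have "\<dots> = inner (M *v (?N *v y)) y"
      by (simp add: inner_hermitian_adjoint)
    also have "\<dots> \<le> norm (M *v (?N *v y)) * norm y"
      by (rule norm_cauchy_schwarz)
    also have "\<dots> \<le> L * norm (?N *v y) * norm y"
      by (intro mult_right_mono bound) simp
    finally show ?thesis
      using False by (simp add: mult.assoc mult.commute mult.left_commute)
  qed (use L in simp)
  let ?z = "?N *v (M *v v)"
  have z: "inner ?z v = L\<^sup>2"
    using v(2) by (metis inner_commute inner_hermitian_adjoint power2_norm_eq_inner)
  have "norm ?z \<le> L\<^sup>2"
    using adj[of "M *v v"] v by (simp add: power2_eq_square)
  then have "inner ?z ?z \<le> L\<^sup>2 * L\<^sup>2"
    by (metis norm_ge_zero power2_eq_square power2_norm_eq_inner power_mono)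
  moreover have "inner v v = 1"
    using v(1) by (simp add: norm_eq_1)
  \<comment> \<open>The square expands to at most \<open>L^4 - 2 * L^4 + L^4\<close>.\<close>
  ultimately have "inner (?z - L\<^sup>2 *\<^sub>R v) (?z - L\<^sup>2 *\<^sub>R v) \<le> 0"
    using z by (simp add: inner_diff_left inner_diff_right inner_commute algebra_simps)
  then have "?z = L\<^sup>2 *\<^sub>R v"
    by (metis inner_ge_zero inner_eq_zero_iff order_antisym right_minus_eq)
  then show "L \<in> {r. singular_value M r}"
    using L v(1) by (auto simp: singular_value_iff intro!: exI[of _ v])
qed

lemma sigma_max_zero: "sigma_max (0 :: complex^'n^'n) = 0"
proof -
  obtain v :: "complex^'n" where "norm v = 1"
    using vector_choose_size[of 1] by auto
  then show ?thesis
    by (intro sigma_max_eqI[of _ _ v]) auto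
qed

section \<open>The smallest gain of a matrix\<close>

text \<open>This is the smallest singular value, written as an infimum over the unit sphere so that
  no spectral theory is involved.\<close>

definition least_gain :: "complex^'n^'n \<Rightarrow> real" where
  "least_gain M = (INF v\<in>sphere 0 1. norm (M *v v))"

lemma least_gain_attained:
  fixes M :: "complex^'n^'n"
  obtains v where "norm v = 1" "norm (M *v v) = least_gain M"
proof -
  obtain u :: "complex^'n" where "norm u = 1"
    using vector_choose_size[of 1] by auto
  then have "sphere (0 :: complex^'n) 1 \<noteq> {}"
    by auto
  moreover have "bounded_linear ((*v) M)"
    by (rule matrix_vector_mul_bounded_linear)
  then have "continuous_on (sphere 0 1) (\<lambda>v. norm (M *v v))"
    by (intro continuous_on_norm linear_continuous_on)
  ultimately obtain v where v: "v \<in> sphere 0 1"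
    "\<forall>w\<in>sphere 0 1. norm (M *v v) \<le> norm (M *v w)"
    using continuous_attains_inf[OF compact_sphere, of 0 1 "\<lambda>v. norm (M *v v)"] by blast
  then have "least_gain M = norm (M *v v)"
    unfolding least_gain_def by (intro cInf_eq_minimum) auto
  with v that show thesis
    by auto
qed

lemma least_gain_le:
  fixes M :: "complex^'n^'n"
  assumes "norm v = 1"
  shows "least_gain M \<le> norm (M *v v)"
  unfolding least_gain_def
  by (rule cINF_lower) (use assms in \<open>auto intro: bdd_belowI[of _ 0]\<close>)

lemma least_gain_mult_le:
  fixes M :: "complex^'n^'n"
  shows "least_gain M * norm v \<le> norm (M *v v)"
proof (cases "v = 0")
  case False
  have "M *v (v /\<^sub>R norm v) = (M *v v) /\<^sub>R norm v"
    by (rule linear_scale[OF matrix_vector_mul_linear])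
  then have "least_gain M \<le> norm (M *v v) / norm v"
    using least_gain_le[of "v /\<^sub>R norm v" M] False by (simp add: divide_inverse mult.commute)
  then show ?thesis
    using False by (simp add: field_simps)
qed simp

text \<open>The minimiser of each matrix serves as test vector for the other, which bounds the
  difference from both sides.\<close>

lemma least_gain_perturb:
  fixes M N :: "complex^'n^'n"
  assumes "\<And>v. norm v = 1 \<Longrightarrow> norm (M *v v - N *v v) \<le> c"
  shows "\<bar>least_gain M - least_gain N\<bar> \<le> c"
proof -
  obtain v where v: "norm v = 1" "norm (M *v v) = least_gain M"
    by (rule least_gain_attained)
  obtain w where w: "norm w = 1" "norm (N *v w) = least_gain N"
    by (rule least_gain_attained)
  have "norm (N *v v) \<le> norm (M *v v) + c"
    using assms[OF v(1)] norm_triangle_ineq2[of "N *v v" "M *v v"]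
    by (simp add: norm_minus_commute)
  moreover have "norm (M *v w) \<le> norm (N *v w) + c"
    using assms[OF w(1)] norm_triangle_ineq2[of "M *v w" "N *v w"] by simp
  ultimately show ?thesis
    using least_gain_le[OF v(1), of N] least_gain_le[OF w(1), of M] v(2) w(2) by linarith
qed

lemma least_gain_scaleR:
  fixes M N :: "complex^'n^'n"
  assumes "0 \<le> c" "\<And>v. norm (N *v v) = c * norm (M *v v)"
  shows "least_gain N = c * least_gain M"
proof (rule antisym)
  obtain v where v: "norm v = 1" "norm (M *v v) = least_gain M"
    by (rule least_gain_attained)
  then show "least_gain N \<le> c * least_gain M"
    using least_gain_le[OF v(1), of N] assms by simp
  obtain w where w: "norm w = 1" "norm (N *v w) = least_gain N"
    by (rule least_gain_attained)
  then show "c * least_gain M \<le> least_gain N"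
    using least_gain_le[OF w(1), of M] assms by (metis mult_left_mono)
qed

lemma least_gain_pos:
  fixes M :: "complex^'n^'n"
  assumes "\<And>v. v \<noteq> 0 \<Longrightarrow> M *v v \<noteq> 0"
  shows "0 < least_gain M"
  by (metis assms least_gain_attained norm_zero zero_less_norm_iff zero_neq_one)

text \<open>A positive least gain makes the kernel trivial, so the square matrix is invertible, and
  the direction that \<open>M\<close> shrinks most is the one its inverse stretches most.\<close>

lemma sigma_max_matrix_inv:
  fixes M :: "complex^'n^'n"
  assumes pos: "0 < least_gain M"
  shows "sigma_max (matrix_inv M) = 1 / least_gain M"
proof -
  have "M *v v = 0 \<Longrightarrow> v = 0" for v
    using least_gain_mult_le[of M v] pos by (simp add: mult_le_0_iff)
  then obtain B where "B ** M = mat 1"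
    using matrix_left_invertible_ker[of M] by auto
  then have "invertible M"
    by (rule invertible_left_inverse[THEN iffD2, OF exI])
  then have "M ** matrix_inv M = mat 1 \<and> matrix_inv M ** M = mat 1"
    unfolding invertible_def matrix_inv_def by (rule someI_ex)
  then have inv: "M *v (matrix_inv M *v x) = x" "matrix_inv M *v (M *v x) = x" for x
    by (simp_all add: matrix_vector_mul_assoc)
  obtain v where v: "norm v = 1" "norm (M *v v) = least_gain M"
    by (rule least_gain_attained)
  \<comment> \<open>The normalised image of the minimiser is a unit vector at which the inverse has
    its largest gain.\<close>
  let ?w = "(M *v v) /\<^sub>R least_gain M"
  have "matrix_inv M *v ?w = v /\<^sub>R least_gain M"
    by (simp add: linear_scale[OF matrix_vector_mul_linear] inv)
  then have "norm (matrix_inv M *v ?w) = 1 / least_gain M"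
    using v pos by (simp add: divide_inverse)
  moreover have "norm ?w = 1"
    using v pos by simp
  moreover have "norm (matrix_inv M *v x) \<le> 1 / least_gain M * norm x" for x
    using least_gain_mult_le[of M "matrix_inv M *v x"] pos by (simp add: inv field_simps)
  ultimately show ?thesis
    by (intro sigma_max_eqI[of _ _ ?w])
qed

section \<open>Pencils of a stable matrix\<close>

text \<open>One family for both sides of the identity: resolvents of \<open>A\<close> belong to
  \<open>t = 1\<close>, the transfer functions to the line \<open>Re s = 1\<close>, and
  \<open>\<delta> = 1\<close> becomes \<open>t = 0\<close>.\<close>

definition pencil :: "real^'n^'n \<Rightarrow> real \<Rightarrow> complex \<Rightarrow> complex^'n^'n" where
  "pencil A t s = mat s - t *\<^sub>R complex_matrix A"

lemma pencil_mult_vec: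
  fixes A :: "real^'n^'n"
  shows "pencil A t s *v v = s *s v - t *\<^sub>R (complex_matrix A *v v)"
proof -
  have "(t *\<^sub>R complex_matrix A) *v v = t *\<^sub>R (complex_matrix A *v v)"
    by (simp add: vec_eq_iff matrix_vector_mult_def scaleR_sum_right)
  then show ?thesis
    by (simp add: pencil_def matrix_vector_mult_diff_rdistrib mat_mult_vec)
qed

lemma complex_matrix_bound:
  fixes A :: "real^'n^'n"
  obtains C where "0 < C" "\<And>v. norm (complex_matrix A *v v) \<le> C * norm v"
  using bounded_linear.pos_bounded[OF matrix_vector_mul_bounded_linear[of "complex_matrix A"]]
  by (metis mult.commute)

text \<open>Varying \<open>s\<close> alone gives continuity; comparison with \<open>t = 0\<close>
  gives growth like \<open>cmod s\<close> at infinity.\<close>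

lemma least_gain_pencil_diff:
  fixes A :: "real^'n^'n"
  assumes "\<And>v. norm (complex_matrix A *v v) \<le> C * norm v"
  shows "\<bar>least_gain (pencil A t s) - least_gain (pencil A t' s')\<bar>
    \<le> cmod (s - s') + \<bar>t - t'\<bar> * C"
proof (rule least_gain_perturb)
  fix v :: "complex^'n" assume v: "norm v = 1"
  have "pencil A t s *v v - pencil A t' s' *v v
      = (s - s') *s v - (t - t') *\<^sub>R (complex_matrix A *v v)"
    by (simp add: pencil_mult_vec vec_eq_iff algebra_simps)
  also have "norm \<dots> \<le> norm ((s - s') *s v) + norm ((t - t') *\<^sub>R (complex_matrix A *v v))"
    by (rule norm_triangle_ineq4)
  also have "\<dots> = cmod (s - s') + \<bar>t - t'\<bar> * norm (complex_matrix A *v v)"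
    unfolding norm_vector_scalar_mult norm_scaleR v by simp
  also have "\<dots> \<le> cmod (s - s') + \<bar>t - t'\<bar> * C"
    using assms[of v] v by (simp add: mult_left_mono)
  finally show "norm (pencil A t s *v v - pencil A t' s' *v v) \<le> cmod (s - s') + \<bar>t - t'\<bar> * C" .
qed

lemma least_gain_pencil_zero:
  fixes A :: "real^'n^'n"
  shows "least_gain (pencil A 0 s) = cmod s"
proof -
  obtain v where v: "norm v = 1" "norm (pencil A 0 s *v v) = least_gain (pencil A 0 s)"
    by (rule least_gain_attained)
  then show ?thesis
    by (simp add: pencil_mult_vec norm_vector_scalar_mult)
qed

lemma least_gain_pencil_bounds:
  fixes A :: "real^'n^'n"
  assumes "\<And>v. norm (complex_matrix A *v v) \<le> C * norm v" "0 \<le> t"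
  shows "\<bar>least_gain (pencil A t s) - cmod s\<bar> \<le> t * C"
  using least_gain_pencil_diff[OF assms(1), of t s 0 s] assms(2)
  by (simp add: least_gain_pencil_zero)

lemma continuous_on_least_gain_pencil:
  fixes A :: "real^'n^'n"
  shows "continuous_on S (\<lambda>s. least_gain (pencil A t s))"
proof -
  obtain C where C: "0 < C" "\<And>v. norm (complex_matrix A *v v) \<le> C * norm v"
    using complex_matrix_bound[of A] by blast
  have "1-lipschitz_on S (\<lambda>s. least_gain (pencil A t s))"
    using least_gain_pencil_diff[OF C(2), of t _ t]
    by (intro lipschitz_onI) (simp_all add: dist_norm)
  then show ?thesis
    by (rule lipschitz_on_continuous_on)
qed

text \<open>Since \<open>A\<close> is real, entrywise conjugation is an isometry that carries the
  pencil at \<open>s\<close> to the one at \<open>cnj s\<close>. Gains are therefore even in the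
  frequency.\<close>

lemma least_gain_pencil_cnj:
  fixes A :: "real^'n^'n"
  shows "least_gain (pencil A t (cnj s)) = least_gain (pencil A t s)"
proof -
  define c :: "complex^'n \<Rightarrow> complex^'n" where "c v = (\<chi> i. cnj (v $ i))" for v
  have nc: "norm (c v) = norm v" for v
    by (simp add: c_def norm_vec_def)
  have "pencil A t (cnj s) $ i $ j = cnj (pencil A t s $ i $ j)" for s i j
    by (simp add: pencil_def mat_def map_matrix_def)
  then have pc: "pencil A t (cnj s) *v c v = c (pencil A t s *v v)" for s v
    by (simp add: c_def vec_eq_iff matrix_vector_mult_def)
  have le: "least_gain (pencil A t (cnj s)) \<le> least_gain (pencil A t s)" for s
    by (metis least_gain_attained least_gain_le nc pc)
  show ?thesis
    using le[of s] le[of "cnj s"] by simp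
qed

text \<open>This homogeneity is what turns gains on the line \<open>Re s = 1\<close> into Kreiss
  quotients.\<close>

lemma least_gain_pencil_scale:
  fixes A :: "real^'n^'n"
  assumes "0 < c"
  shows "least_gain (pencil A (c * t) (c *\<^sub>R s)) = c * least_gain (pencil A t s)"
proof (rule least_gain_scaleR)
  fix v
  have "pencil A (c * t) (c *\<^sub>R s) *v v = c *\<^sub>R (pencil A t s *v v)"
    by (simp add: pencil_mult_vec vec_eq_iff algebra_simps)
  then show "norm (pencil A (c * t) (c *\<^sub>R s) *v v) = c * norm (pencil A t s *v v)"
    using assms by simp
qed (use assms in simp)

text \<open>A kernel vector would be an eigenvector for \<open>s\<close>, which stability
  excludes.\<close>

lemma least_gain_pencil_pos_one:
  fixes A :: "real^'n^'n"
  assumes "stable A" "0 \<le> Re s"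
  shows "0 < least_gain (pencil A 1 s)"
proof (rule least_gain_pos)
  fix v :: "complex^'n" assume "v \<noteq> 0"
  moreover have "\<not> eigenvalue (complex_matrix A) s"
    using assms unfolding stable_def by force
  ultimately show "pencil A 1 s *v v \<noteq> 0"
    by (auto simp: pencil_mult_vec eigenvalue_def)
qed

lemma least_gain_pencil_pos:
  fixes A :: "real^'n^'n"
  assumes "stable A" "0 \<le> t" "0 < Re s"
  shows "0 < least_gain (pencil A t s)"
proof (cases "t = 0")
  case True
  then show ?thesis
    using assms by (auto simp: least_gain_pencil_zero)
next
  case False
  then have "least_gain (pencil A t s) = t * least_gain (pencil A 1 (s /\<^sub>R t))"
    using least_gain_pencil_scale[of t A 1 "s /\<^sub>R t"] assms by simp
  moreover have "0 < least_gain (pencil A 1 (s /\<^sub>R t))"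
    using assms False by (intro least_gain_pencil_pos_one) simp_all
  ultimately show ?thesis
    using assms False by simp
qed

lemma sigma_max_resolvent:
  fixes A :: "real^'n^'n"
  assumes "stable A" "0 \<le> Re s"
  shows "sigma_max (resolvent A s) = 1 / least_gain (pencil A 1 s)"
  using sigma_max_matrix_inv[OF least_gain_pencil_pos_one[OF assms]]
  by (simp add: resolvent_def pencil_def)

text \<open>The summand \<open>- mat 1\<close> shifts the imaginary axis to the line
  \<open>Re s = 1\<close>. The value \<open>\<delta> = -1\<close>, where the transfer function is
  zero by convention, stays outside this formula.\<close>

lemma sigma_max_kreiss_transfer:
  fixes A :: "real^'n^'n"
  assumes "stable A" "\<delta> \<in> {-1<..1}"
  shows "sigma_max (kreiss_transfer A \<delta> (\<i> * complex_of_real w))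
    = 1 / least_gain (pencil A ((1 - \<delta>) / (1 + \<delta>)) (Complex 1 w))"
proof -
  let ?t = "(1 - \<delta>) / (1 + \<delta>)"
  have "mat (\<i> * complex_of_real w) - complex_matrix (?t *\<^sub>R A - mat 1) = pencil A ?t (Complex 1 w)"
    unfolding pencil_def
    by (auto simp: vec_eq_iff map_matrix_def mat_def complex_eq_iff)
  then have "kreiss_transfer A \<delta> (\<i> * complex_of_real w) = matrix_inv (pencil A ?t (Complex 1 w))"
    using assms by (simp add: kreiss_transfer_def resolvent_def)
  moreover have "0 < least_gain (pencil A ?t (Complex 1 w))"
    using assms by (intro least_gain_pencil_pos) auto
  ultimately show ?thesis
    by (simp add: sigma_max_matrix_inv)
qed

section \<open>The change of variables\<close>

text \<open>The Moebius map \<open>\<delta> \<mapsto> (1 - \<delta>) / (1 + \<delta>)\<close> identifies the open interval with the positive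
  numbers; \<open>s = (1 + \<i> w) (1 + \<delta>) / (1 - \<delta>)\<close> then runs through the open right half-plane.\<close>

lemma kreiss_quotient_eq_gain:
  fixes A :: "real^'n^'n"
  assumes "stable A" "0 < Re s"
  defines "\<delta> \<equiv> (Re s - 1) / (Re s + 1)"
  shows "\<delta> \<in> {-1<..<1}"
    and "Re s * sigma_max (resolvent A s)
      = sigma_max (kreiss_transfer A \<delta> (\<i> * complex_of_real (Im s / Re s)))"
proof -
  show \<delta>: "\<delta> \<in> {-1<..<1}"
    using assms(2) by (simp add: \<delta>_def field_simps)
  have parts: "1 - \<delta> = 2 / (Re s + 1)" "1 + \<delta> = 2 * Re s / (Re s + 1)"
    using assms(2) by (simp_all add: \<delta>_def field_simps)
  \<comment> \<open>\<open>\<delta>\<close> is the preimage of \<open>1 / Re s\<close> under the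
    Moebius map.\<close>
  have t: "(1 - \<delta>) / (1 + \<delta>) = inverse (Re s)"
    unfolding parts using assms(2) by (simp add: divide_simps)
  have s: "Complex 1 (Im s / Re s) = s /\<^sub>R Re s"
    using assms(2) by (simp add: complex_eq_iff divide_inverse mult.commute)
  have "least_gain (pencil A (inverse (Re s)) (s /\<^sub>R Re s)) = least_gain (pencil A 1 s) / Re s"
    using least_gain_pencil_scale[of "inverse (Re s)" A 1 s] assms(2)
    by (simp add: divide_inverse mult.commute)
  then show "Re s * sigma_max (resolvent A s)
      = sigma_max (kreiss_transfer A \<delta> (\<i> * complex_of_real (Im s / Re s)))"
    using sigma_max_kreiss_transfer[OF assms(1), of \<delta> "Im s / Re s"] assms(1,2) \<delta>
    by (simp add: t s sigma_max_resolvent)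
qed

lemma gain_eq_kreiss_quotient:
  fixes A :: "real^'n^'n"
  assumes "stable A" "\<delta> \<in> {-1<..<1}"
  obtains s where "0 < Re s"
    "sigma_max (kreiss_transfer A \<delta> (\<i> * complex_of_real w)) = Re s * sigma_max (resolvent A s)"
proof -
  \<comment> \<open>\<open>r\<close> is the reciprocal of the Moebius image of
    \<open>\<delta>\<close>; the point sought is \<open>r * (1 + \<i> * w)\<close>.\<close>
  define r where "r = (1 + \<delta>) / (1 - \<delta>)"
  have r: "0 < r"
    using assms by (simp add: r_def)
  have "(r - 1) / (r + 1) = \<delta>"
    using assms by (simp add: r_def field_simps)
  with kreiss_quotient_eq_gain(2)[of A "Complex r (r * w)"] assms r show thesis
    by (intro that[of "Complex r (r * w)"]) simp_all
qed

section \<open>Attainment of the maxima\<close>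

text \<open>For \<open>\<delta> \<noteq> -1\<close> the gain is continuous, and beyond some
  frequency it is at most its value at \<open>0\<close>, so a compact interval suffices.\<close>

lemma kreiss_gain_has_maximum:
  fixes A :: "real^'n^'n"
  assumes "stable A" "\<delta> \<in> {-1..1}"
  shows "\<exists>m. is_maximum (kreiss_gain A \<delta>) {0..\<infinity>} m"
proof (cases "\<delta> = -1")
  case True
  then have "kreiss_gain A \<delta> w = 0" for w
    by (simp add: kreiss_gain_def kreiss_transfer_def sigma_max_zero)
  then have "is_maximum (kreiss_gain A \<delta>) {0..\<infinity>} 0"
    by (auto simp: is_maximum_def)
  then show ?thesis ..
next
  case False
  define t where "t = (1 - \<delta>) / (1 + \<delta>)"
  define h where "h w = 1 / least_gain (pencil A t (Complex 1 w))" for w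
  have t: "0 \<le> t"
    using assms False by (simp add: t_def)
  have gain: "kreiss_gain A \<delta> (ereal w) = h w" for w
    using assms False
    by (simp add: kreiss_gain_def h_def t_def sigma_max_kreiss_transfer)
  have pos: "0 < least_gain (pencil A t (Complex 1 w))" for w
    using assms t by (intro least_gain_pencil_pos) auto
  then have h0: "0 < h 0"
    by (simp add: h_def)
  obtain C where C: "0 < C" "\<And>v. norm (complex_matrix A *v v) \<le> C * norm v"
    using complex_matrix_bound[of A] by blast
  \<comment> \<open>From \<open>\<rho>\<close> on, the least gain is at least
    \<open>w - t * C\<close>, hence at least \<open>1 / h 0\<close>.\<close>
  define \<rho> where "\<rho> = t * C + 1 / h 0"
  have \<rho>: "0 \<le> \<rho>"
    using t C(1) h0 by (simp add: \<rho>_def)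
  have far: "h w \<le> h 0" if "\<rho> \<le> w" for w
  proof -
    have "w \<le> cmod (Complex 1 w)"
      using abs_Im_le_cmod[of "Complex 1 w"] by simp
    then have "1 / h 0 \<le> least_gain (pencil A t (Complex 1 w))"
      using least_gain_pencil_bounds[OF C(2) t, of "Complex 1 w"] that by (simp add: \<rho>_def)
    then show ?thesis
      using h0 pos[of w] unfolding h_def[of w] by (simp add: field_simps)
  qed
  have "continuous_on {0..\<rho>} (\<lambda>w. least_gain (pencil A t (Complex 1 w)))"
    by (rule continuous_on_compose2[OF continuous_on_least_gain_pencil[of UNIV]])
      (auto simp: Complex_eq intro!: continuous_intros)
  then have "continuous_on {0..\<rho>} h"
    unfolding h_def using pos by (intro continuous_intros) (auto simp: less_imp_neq[symmetric])
  then obtain u where u: "u \<in> {0..\<rho>}" "\<And>w. w \<in> {0..\<rho>} \<Longrightarrow> h w \<le> h u"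
    using continuous_attains_sup[of "{0..\<rho>}" h] \<rho> by auto
  have max: "h w \<le> h u" if "0 \<le> w" for w
    using u(2)[of w] u(2)[of 0] far[of w] that \<rho> by fastforce
  have "is_maximum (kreiss_gain A \<delta>) {0..\<infinity>} (h u)"
    unfolding is_maximum_def
  proof (intro conjI bexI ballI)
    show "kreiss_gain A \<delta> (ereal u) = h u"
      by (rule gain)
    show "ereal u \<in> {0..\<infinity>}"
      using u by simp
    fix w :: ereal assume "w \<in> {0..\<infinity>}"
    then show "kreiss_gain A \<delta> w \<le> h u"
      \<comment> \<open>The infinite frequency has gain \<open>0\<close>, which lies below
        \<open>h 0\<close>.\<close>
      using max max[of 0] h0 gain by (cases w) (force simp: kreiss_gain_def)+
  qed
  then show ?thesis ..
qed

text \<open>The supremum runs over all real frequencies, the maximum over nonnegative ones and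
  infinity. Evenness removes the sign.\<close>

lemma Hinf_norm_kreiss_transfer:
  fixes A :: "real^'n^'n"
  assumes "stable A" "\<delta> \<in> {-1..1}" and m: "is_maximum (kreiss_gain A \<delta>) {0..\<infinity>} m"
  shows "Hinf_norm (kreiss_transfer A \<delta>) = ereal m"
proof -
  define h where "h w = sigma_max (kreiss_transfer A \<delta> (\<i> * complex_of_real w))" for w
  have h_abs: "h w = h \<bar>w\<bar>" for w
  proof (cases "\<delta> = -1")
    case True
    then show ?thesis
      by (simp add: h_def kreiss_transfer_def)
  next
    case False
    have "Complex 1 \<bar>w\<bar> = Complex 1 w \<or> Complex 1 \<bar>w\<bar> = cnj (Complex 1 w)"
      by (auto simp: complex_eq_iff abs_if)
    then show ?thesis
      using assms False by (auto simp: h_def sigma_max_kreiss_transfer least_gain_pencil_cnj)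
  qed
  have gain: "kreiss_gain A \<delta> (ereal w) = h w" for w
    by (simp add: kreiss_gain_def h_def)
  have nonneg: "0 \<le> h w" for w
  proof (cases "\<delta> = -1")
    case True
    then show ?thesis
      by (simp add: h_def kreiss_transfer_def sigma_max_zero)
  next
    case False
    then have "0 < least_gain (pencil A ((1 - \<delta>) / (1 + \<delta>)) (Complex 1 w))"
      using assms by (intro least_gain_pencil_pos) auto
    with False show ?thesis
      using assms by (simp add: h_def sigma_max_kreiss_transfer)
  qed
  have le: "h w \<le> m" for w
    using m gain[of "\<bar>w\<bar>"] unfolding h_abs[of w] is_maximum_def
    by (metis abs_ge_zero atLeastAtMost_iff ereal_less_eq(1) ereal_less_eq(5))
  obtain x where x: "x \<in> {0..\<infinity>}" "kreiss_gain A \<delta> x = m"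
    using m by (auto simp: is_maximum_def)
  have "\<exists>u. h u = m"
  proof (cases x)
    case (real r)
    then show ?thesis
      using x gain by auto
  next
    case PInf
    \<comment> \<open>A maximum at infinity forces all gains to vanish, so it is also attained at
      frequency \<open>0\<close>.\<close>
    then have "m = 0"
      using x by (simp add: kreiss_gain_def)
    then show ?thesis
      using le[of 0] nonneg[of 0] by (intro exI[of _ 0]) simp
  qed (use x in auto)
  then obtain u where "h u = m" ..
  then show ?thesis
    unfolding Hinf_norm_def h_def[symmetric]
    using le by (intro antisym SUP_least SUP_upper2[of u]) auto
qed

text \<open>At real \<open>x > 0\<close> the quotient is at least \<open>x / (x + C)\<close>, which
  tends to \<open>1\<close>.\<close>

lemma kreiss_constant_ge_one:
  fixes A :: "real^'n^'n"
  assumes "stable A"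
  shows "1 \<le> kreiss_constant A"
proof -
  obtain C where C: "0 < C" "\<And>v. norm (complex_matrix A *v v) \<le> C * norm v"
    using complex_matrix_bound[of A] by blast
  have "ereal (x / (x + C)) \<le> kreiss_constant A" if "0 < x" for x
  proof -
    have "least_gain (pencil A 1 (complex_of_real x)) \<le> x + C"
      using least_gain_pencil_bounds[OF C(2), of 1 "complex_of_real x"] that by simp
    moreover have "0 < least_gain (pencil A 1 (complex_of_real x))"
      using assms that by (intro least_gain_pencil_pos_one) simp_all
    ultimately have "x / (x + C) \<le> x * sigma_max (resolvent A (complex_of_real x))"
      using assms that by (simp add: sigma_max_resolvent frac_le)
    then show ?thesis
      unfolding kreiss_constant_def using that
      by (intro SUP_upper2[of "complex_of_real x"]) simp_all
  qed
  then have ev: "\<forall>\<^sub>F x in at_top. ereal (x / (x + C)) \<le> kreiss_constant A"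
    using eventually_gt_at_top[of 0] by (rule eventually_mono[rotated])
  have "((\<lambda>x. x / (x + C)) \<longlongrightarrow> 1) at_top"
  proof -
    have "((\<lambda>x. C / (x + C)) \<longlongrightarrow> 0) at_top"
      by (intro real_tendsto_divide_at_top[OF tendsto_const]
          filterlim_tendsto_add_at_top[OF tendsto_const filterlim_ident, of C, simplified add.commute])
    then have "((\<lambda>x. 1 - C / (x + C)) \<longlongrightarrow> 1 - 0) at_top"
      by (intro tendsto_diff tendsto_const)
    moreover have "\<forall>\<^sub>F x in at_top. 1 - C / (x + C) = x / (x + C)"
      using eventually_gt_at_top[of 0] by eventually_elim (use C(1) in \<open>simp add: field_simps\<close>)
    ultimately show ?thesis
      by (simp add: filterlim_cong)
  qed
  then have "((\<lambda>x. ereal (x / (x + C))) \<longlongrightarrow> ereal 1) at_top"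
    by (rule tendsto_ereal)
  from tendsto_upperbound[OF this ev] show ?thesis
    by (simp add: one_ereal_def)
qed

text \<open>At infinity the quotient is bounded by a quantity tending to \<open>1\<close> and on the imaginary axis it
  vanishes, so a supremum above \<open>1\<close> is attained in the interior.\<close>

lemma kreiss_constant_attained:
  fixes A :: "real^'n^'n"
  assumes "stable A" "1 < kreiss_constant A"
  obtains s where "0 < Re s" "kreiss_constant A = ereal (Re s * sigma_max (resolvent A s))"
proof -
  \<comment> \<open>This formula extends the quotient continuously to the closed right half-plane,
    where the least gain is still positive.\<close>
  define F where "F s = Re s / least_gain (pencil A 1 s)" for s
  have F: "Re s * sigma_max (resolvent A s) = F s" if "0 < Re s" for s
    using that assms(1) by (simp add: F_def sigma_max_resolvent)
  obtain s0 where s0: "0 < Re s0" "1 < F s0"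
    using assms(2) F unfolding kreiss_constant_def less_SUP_iff by auto
  obtain C where C: "0 < C" "\<And>v. norm (complex_matrix A *v v) \<le> C * norm v"
    using complex_matrix_bound[of A] by blast
  \<comment> \<open>the solution of \<open>\<rho> / (\<rho> - C) = F s0\<close>\<close>
  define \<rho> where "\<rho> = C * F s0 / (F s0 - 1)"
  have far: "F s \<le> F s0" if "0 < Re s" "\<rho> \<le> cmod s" for s
  proof -
    \<comment> \<open>Rearranged, this reads \<open>cmod s \<le> F s0 * (cmod s - C)\<close>, and
      \<open>cmod s - C\<close> bounds the least gain from below.\<close>
    have "C * F s0 \<le> cmod s * (F s0 - 1)"
      using that(2) s0 by (simp add: \<rho>_def field_simps)
    then have "Re s \<le> F s0 * (cmod s - C)"
      using complex_Re_le_cmod[of s] by (simp add: algebra_simps)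
    also have "\<dots> \<le> F s0 * least_gain (pencil A 1 s)"
      using least_gain_pencil_bounds[OF C(2), of 1 s] s0 by (intro mult_left_mono) simp_all
    finally show ?thesis
      using least_gain_pencil_pos_one[OF assms(1), of s] that by (simp add: F_def[of s] field_simps)
  qed
  define K where "K = cball 0 (max \<rho> (cmod s0)) \<inter> {s. 0 \<le> Re s}"
  have "compact K"
    unfolding K_def by (intro compact_Int_closed compact_cball closed_halfspace_Re_ge)
  moreover have "s0 \<in> K"
    using s0 by (simp add: K_def)
  moreover have "continuous_on K F"
    unfolding F_def
    by (intro continuous_intros continuous_on_least_gain_pencil)
      (use assms(1) least_gain_pencil_pos_one in \<open>force simp: K_def\<close>)
  ultimately obtain s1 where s1: "s1 \<in> K" "\<And>s. s \<in> K \<Longrightarrow> F s \<le> F s1"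
    using continuous_attains_sup[of K F] by blast
  have "F s0 \<le> F s1"
    using s1 \<open>s0 \<in> K\<close> by blast
  then have "Re s1 \<noteq> 0"
    using s0 by (auto simp: F_def)
  then have pos: "0 < Re s1"
    using s1(1) by (simp add: K_def)
  have "F s \<le> F s1" if "0 < Re s" for s
  proof (cases "s \<in> K")
    case False
    then have "\<rho> \<le> cmod s"
      using that by (auto simp: K_def)
    then show ?thesis
      using far[OF that] \<open>F s0 \<le> F s1\<close> by linarith
  qed (rule s1)
  then have "kreiss_constant A = ereal (F s1)"
    unfolding kreiss_constant_def using pos F
    by (intro antisym SUP_least SUP_upper2[of s1]) auto
  with that pos F show thesis
    by simp
qed

theorem theorem1:
  fixes A :: "real^'n^'n"
  assumes "stable A"
  shows "is_maximum (\<lambda>\<delta>::real. Hinf_norm (kreiss_transfer A \<delta>)) {-1..1} (kreiss_constant A) \<and>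
    (\<exists>g :: real \<Rightarrow> real.
       (\<forall>\<delta>\<in>{-1..1}. is_maximum (kreiss_gain A \<delta>) {0..\<infinity>} (g \<delta>)) \<and>
       is_maximum (\<lambda>\<delta>. ereal (g \<delta>)) {-1..1} (kreiss_constant A))"
proof -
  obtain g where g: "\<And>\<delta>. \<delta> \<in> {-1..1} \<Longrightarrow> is_maximum (kreiss_gain A \<delta>) {0..\<infinity>} (g \<delta>)"
    using kreiss_gain_has_maximum[OF assms] by metis
  have gain_one: "sigma_max (kreiss_transfer A 1 (\<i> * complex_of_real w)) = 1 / cmod (Complex 1 w)"
    for w
    using assms by (simp add: sigma_max_kreiss_transfer least_gain_pencil_zero)
  \<comment> \<open>Interior \<delta> give Kreiss quotients; at the endpoints the gains are at most
    \<open>1\<close>, which \<open>kreiss_constant_ge_one\<close> covers.\<close>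
  have upper: "Hinf_norm (kreiss_transfer A \<delta>) \<le> kreiss_constant A" if "\<delta> \<in> {-1..1}" for \<delta>
    unfolding Hinf_norm_def
  proof (rule SUP_least)
    fix w
    have "\<delta> = -1 \<or> \<delta> = 1 \<or> \<delta> \<in> {-1<..<1}"
      using that by auto
    then consider "\<delta> = -1" | "\<delta> = 1" | "\<delta> \<in> {-1<..<1}"
      by blast
    then show "ereal (sigma_max (kreiss_transfer A \<delta> (\<i> * complex_of_real w))) \<le> kreiss_constant A"
    proof cases
      case 1
      then show ?thesis
        using order_trans[OF _ kreiss_constant_ge_one[OF assms], of 0]
        by (simp add: kreiss_transfer_def sigma_max_zero zero_ereal_def)
    next
      case 2
      have "1 \<le> cmod (Complex 1 w)"
        using abs_Re_le_cmod[of "Complex 1 w"] by simp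
      then have "ereal (1 / cmod (Complex 1 w)) \<le> 1"
        by (simp add: one_ereal_def divide_le_eq_1)
      then show ?thesis
        using kreiss_constant_ge_one[OF assms] 2 gain_one by (metis order_trans)
    next
      case 3
      then obtain s where "0 < Re s"
        "sigma_max (kreiss_transfer A \<delta> (\<i> * complex_of_real w)) = Re s * sigma_max (resolvent A s)"
        using gain_eq_kreiss_quotient[OF assms] by blast
      then show ?thesis
        unfolding kreiss_constant_def by (auto intro: SUP_upper2)
    qed
  qed
  \<comment> \<open>A constant above \<open>1\<close> is reached at the \<delta> of a maximising
    \<open>s\<close>; otherwise \<delta> = 1 and frequency \<open>0\<close> give the value
    \<open>1\<close>.\<close>
  have "\<exists>\<delta>\<in>{-1..1}. kreiss_constant A \<le> Hinf_norm (kreiss_transfer A \<delta>)"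
  proof (cases "1 < kreiss_constant A")
    case True
    then obtain s where s: "0 < Re s" "kreiss_constant A = ereal (Re s * sigma_max (resolvent A s))"
      using kreiss_constant_attained[OF assms] by blast
    let ?\<delta> = "(Re s - 1) / (Re s + 1)"
    note q = kreiss_quotient_eq_gain[OF assms s(1)]
    have "kreiss_constant A \<le> Hinf_norm (kreiss_transfer A ?\<delta>)"
      unfolding s(2) q(2) Hinf_norm_def by (rule SUP_upper) simp
    then show ?thesis
      using q(1) by (intro bexI[of _ ?\<delta>]) auto
  next
    case False
    have "1 \<le> Hinf_norm (kreiss_transfer A 1)"
      unfolding Hinf_norm_def
      by (rule SUP_upper2[of 0])
        (use gain_one[of 0] in \<open>simp_all add: one_ereal_def norm_complex_def\<close>)
    then show ?thesis
      using False by (intro bexI[of _ 1]) auto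
  qed
  then have "is_maximum (\<lambda>\<delta>. Hinf_norm (kreiss_transfer A \<delta>)) {-1..1} (kreiss_constant A)"
    unfolding is_maximum_def using upper by (metis order_antisym)
  \<comment> \<open>On the interval \<open>ereal (g \<delta>)\<close> is the H-infinity norm, so
    both maxima are the same.\<close>
  moreover from this have "is_maximum (\<lambda>\<delta>. ereal (g \<delta>)) {-1..1} (kreiss_constant A)"
    unfolding is_maximum_def by (simp add: Hinf_norm_kreiss_transfer[OF assms _ g])
  ultimately show ?thesis
    using g by blast
qed

end
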